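(* Let $X$ be an Archimedean pervasive pre-Riesz space with a vector lattice cover $(Y,i)$. Let $I\subseteq X$ be a directed ideal and let $\hat{I}\subseteq Y$ be the smallest extension ideal of $I$. Then $(\hat{I},i|_{I})$ is a vector lattice cover of the pre-Riesz space $I$, and $I$ is pervasive.
   Context: All ordered vector spaces are real vector spaces with a partial order given by a cone $X_+$ ($x\le y$ iff $y-x\in X_+$); linear subspaces carry the induced order. $X$ is Archimedean if $nx\le y$ for all $n\in\mathbb{N}$ implies $x\le 0$. A linear subspace $D$ is directed if any two elements of $D$ have an upper bound in $D$. A linear subspace $D$ of an ordered vector space $Z$ is order dense in $Z$ if for every $z\in Z$ one has $z=\inf\{d\in D: z\le d\}$ (infimum in $Z$). A linear map $i$ is bipositive if $i(x)\ge 0\iff x\ge 0$. An ordered vector space $X$ is pre-Riesz if there are a vector lattice $Y$ and a bipositive linear map $i\colon X\to Y$ with $i(X)$ order dense in $Y$; then $(Y,i)$ is called a vector lattice cover of $X$. A pre-Riesz space $X$ is pervasive if for a vector lattice cover $(Y,i)$ (equivalently, for every vector lattice cover) and every $y\in Y_+$, $y\ne 0$, there is $x\in X$ with $0<i(x)\le y$. For $M\subseteq X$ let $M^u$ be the set of upper bounds of $M$ in $X$. A set $M\subseteq X$ is solid if $x\in X$, $y\in M$ and $\{x,-x\}^u\supseteq\{y,-y\}^u$ imply $x\in M$. An ideal is a solid linear subspace (in a vector lattice this is the usual notion). An ideal $J$ of $Y$ is an extension ideal of an ideal $I$ of $X$ if $I=\{x\in X: i(x)\in J\}$. If $I$ has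 an extension ideal (every directed ideal does), then $\hat I$, the intersection of all extension ideals of $I$ in $Y$, is the smallest extension ideal of $I$ in $Y$. *)

theory Defs
  imports Complex_Main "HOL-Library.Lub_Glb"
begin

text \<open>
  An ordered vector space is given by a carrier: a linear subspace of a type of class
  \<^class>\<open>ordered_real_vector\<close> with the induced order. The whole type (carrier \<^term>\<open>UNIV\<close>) is a
  special case. Bounds, suprema and infima are always taken relative to the carrier, via
  \<^const>\<open>ubs\<close>, \<^const>\<open>isLub\<close> and \<^const>\<open>isGlb\<close>; in particular \<^term>\<open>ubs X M\<close> is the set of upper
  bounds of \<^term>\<open>M\<close> in \<^term>\<open>X\<close>.
\<close>

definition archimedean_space :: "'a::ordered_real_vector set \<Rightarrow> bool" where
  "archimedean_space X \<longleftrightarrow>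
     (\<forall>x\<in>X. \<forall>y\<in>X. (\<forall>n::nat. real n *\<^sub>R x \<le> y) \<longrightarrow> x \<le> 0)"

definition directed_subspace :: "'a::ordered_real_vector set \<Rightarrow> bool" where
  "directed_subspace D \<longleftrightarrow> subspace D \<and> (\<forall>x\<in>D. \<forall>y\<in>D. \<exists>z\<in>D. x \<le> z \<and> y \<le> z)"

definition order_dense :: "'a::ordered_real_vector set \<Rightarrow> 'a set \<Rightarrow> bool" where
  "order_dense D Z \<longleftrightarrow>
     subspace D \<and> D \<subseteq> Z \<and> (\<forall>z\<in>Z. isGlb Z {d \<in> D. z \<le> d} z)"

definition vector_lattice :: "'a::ordered_real_vector set \<Rightarrow> bool" where
  "vector_lattice Y \<longleftrightarrow>
     subspace Y \<and> (\<forall>x\<in>Y. \<forall>y\<in>Y. (\<exists>s. isLub Y {x, y} s) \<and> (\<exists>t. isGlb Y {x, y} t))"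

definition linear_map_on ::
    "'a::real_vector set \<Rightarrow> ('a \<Rightarrow> 'b::real_vector) \<Rightarrow> bool" where
  "linear_map_on X f \<longleftrightarrow>
     (\<forall>x\<in>X. \<forall>y\<in>X. f (x + y) = f x + f y) \<and> (\<forall>c. \<forall>x\<in>X. f (c *\<^sub>R x) = c *\<^sub>R f x)"

definition bipositive_on ::
    "'a::ordered_real_vector set \<Rightarrow> ('a \<Rightarrow> 'b::ordered_real_vector) \<Rightarrow> bool" where
  "bipositive_on X f \<longleftrightarrow> (\<forall>x\<in>X. 0 \<le> f x \<longleftrightarrow> 0 \<le> x)"

text \<open>
  Only the values of \<^term>\<open>i\<close> on \<^term>\<open>X\<close> matter below, so if \<^term>\<open>I \<subseteq> X\<close> then
  \<open>vector_lattice_cover I J i\<close> is a statement about the restriction of \<^term>\<open>i\<close> to \<^term>\<open>I\<close>.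
\<close>

definition vector_lattice_cover ::
    "'a::ordered_real_vector set \<Rightarrow> 'b::ordered_real_vector set \<Rightarrow> ('a \<Rightarrow> 'b) \<Rightarrow> bool" where
  "vector_lattice_cover X Y i \<longleftrightarrow>
     subspace X \<and> vector_lattice Y \<and> i ` X \<subseteq> Y \<and>
     linear_map_on X i \<and> bipositive_on X i \<and> order_dense (i ` X) Y"

text \<open>
  The existence of a vector lattice cover quantifies over all vector lattices, which in HOL needs
  a type in which the cover lives; it is passed as an explicit type argument. A hypothesis at an
  arbitrary type \<open>'c\<close> thus expresses the unrestricted existential statement, and a conclusion at
  one particular type implies it.
\<close>

definition pre_riesz_space ::
    "'b::ordered_real_vector itself \<Rightarrow> 'a::ordered_real_vector set \<Rightarrow> bool" where
  "pre_riesz_space (T :: 'b itself) X \<longleftrightarrow> (\<exists>(Y :: 'b set) i. vector_lattice_cover X Y i)"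

definition pervasive_space ::
    "'b::ordered_real_vector itself \<Rightarrow> 'a::ordered_real_vector set \<Rightarrow> bool" where
  "pervasive_space (T :: 'b itself) X \<longleftrightarrow>
     (\<exists>(Y :: 'b set) i. vector_lattice_cover X Y i \<and>
        (\<forall>y\<in>Y. 0 \<le> y \<and> y \<noteq> 0 \<longrightarrow> (\<exists>x\<in>X. 0 < i x \<and> i x \<le> y)))"

definition solid_in :: "'a::ordered_real_vector set \<Rightarrow> 'a set \<Rightarrow> bool" where
  "solid_in X M \<longleftrightarrow>
     M \<subseteq> X \<and> (\<forall>x\<in>X. \<forall>y\<in>M. ubs X {y, - y} \<subseteq> ubs X {x, - x} \<longrightarrow> x \<in> M)"

definition ideal_in :: "'a::ordered_real_vector set \<Rightarrow> 'a set \<Rightarrow> bool" where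
  "ideal_in X I \<longleftrightarrow> subspace I \<and> solid_in X I"

definition extension_ideal ::
    "'a::ordered_real_vector set \<Rightarrow> 'b::ordered_real_vector set \<Rightarrow> ('a \<Rightarrow> 'b) \<Rightarrow>
     'a set \<Rightarrow> 'b set \<Rightarrow> bool" where
  "extension_ideal X Y i I J \<longleftrightarrow> ideal_in Y J \<and> I = {x \<in> X. i x \<in> J}"

text \<open>
  Without any extension ideal this intersection would be \<^term>\<open>UNIV\<close>; a directed ideal
  always has one.
\<close>

definition smallest_extension_ideal ::
    "'a::ordered_real_vector set \<Rightarrow> 'b::ordered_real_vector set \<Rightarrow> ('a \<Rightarrow> 'b) \<Rightarrow>
     'a set \<Rightarrow> 'b set" where
  "smallest_extension_ideal X Y i I = \<Inter>{J. extension_ideal X Y i I J}"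

end

theory Submission
  imports Defs
begin

text \<open>
  Pervasiveness does not depend on the cover, because for elements of the form \<open>(i x)\<^sup>+\<close> it only
  speaks about the upper bounds of \<open>{x, 0}\<close> in \<open>X\<close>, and every nonzero positive element of a
  cover dominates a nonzero element \<open>(i x)\<^sup>+\<close>. The smallest extension ideal \<open>J\<close> consists of all \<open>y\<close> with
  \<open>\<bar>y\<bar> \<le> i a\<close> for some \<open>a \<in> I\<close>, so it is a vector lattice. For order density, reflect at some
  \<open>i a\<close>: it suffices that each positive \<open>u \<in> J\<close> is the supremum of the elements of \<open>i I\<close> below it.
  If \<open>m\<close> is an upper bound with \<open>\<not> u \<le> m\<close>, there is \<open>w\<close> with \<open>0 < i w \<le> u - inf u m\<close>; every
  \<open>d \<in> I\<close> with \<open>0 \<le> i d \<le> u\<close> satisfies \<open>i d \<le> inf u m\<close> and hence \<open>i (d + w) \<le> u\<close>, so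
  \<open>n w\<close> stays below a fixed element of \<open>I\<close> for all \<open>n\<close>, contradicting the Archimedean property.
\<close>

section \<open>Relative bounds in ordered vector spaces\<close>

lemma mem_ubs_pair_iff: "u \<in> ubs R {x, y} \<longleftrightarrow> u \<in> R \<and> x \<le> u \<and> y \<le> u"
  by (auto simp: ubs_def isUb_def setle_def)

lemma isLub_pair_iff:
  "isLub R {x, y} s \<longleftrightarrow>
     s \<in> R \<and> x \<le> s \<and> y \<le> s \<and> (\<forall>u\<in>R. x \<le> u \<and> y \<le> u \<longrightarrow> s \<le> u)"
  by (auto simp: isLub_def leastP_def isUb_def setle_def setge_def)

lemma isGlb_pair_iff:
  "isGlb R {x, y} s \<longleftrightarrow>
     s \<in> R \<and> s \<le> x \<and> s \<le> y \<and> (\<forall>u\<in>R. u \<le> x \<and> u \<le> y \<longrightarrow> u \<le> s)"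
  by (auto simp: isGlb_def greatestP_def isLb_def setle_def setge_def)

lemma isGlb_iff:
  "isGlb R S s \<longleftrightarrow> s \<in> R \<and> (\<forall>x\<in>S. s \<le> x) \<and> (\<forall>l\<in>R. (\<forall>x\<in>S. l \<le> x) \<longrightarrow> l \<le> s)"
  by (auto simp: isGlb_def greatestP_def isLb_def setle_def setge_def)

lemma nonneg_if_abs_le:
  fixes a b :: "'a::ordered_real_vector"
  assumes "a \<le> b" "- a \<le> b"
  shows "0 \<le> b"
proof -
  have "0 \<le> b + b" using add_mono[OF assms] by simp
  then have "0 \<le> (1/2::real) *\<^sub>R (b + b)" by (intro scaleR_nonneg_nonneg) auto
  then show ?thesis by (simp flip: scaleR_2)
qed

section \<open>Linear and order structure of a vector lattice cover\<close>

locale lattice_cover =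
  fixes X :: "'a::ordered_real_vector set"
    and Y :: "'b::ordered_real_vector set"
    and i :: "'a \<Rightarrow> 'b"
  assumes cover: "vector_lattice_cover X Y i"
begin

lemma subspace_X: "subspace X" and subspace_Y: "subspace Y"
  using cover by (auto simp: vector_lattice_cover_def vector_lattice_def)

lemmas X_closed = real_vector.subspace_0[OF subspace_X] real_vector.subspace_add[OF subspace_X]
  real_vector.subspace_diff[OF subspace_X] real_vector.subspace_neg[OF subspace_X]
  real_vector.subspace_scale[OF subspace_X]

lemmas Y_closed = real_vector.subspace_0[OF subspace_Y] real_vector.subspace_add[OF subspace_Y]
  real_vector.subspace_diff[OF subspace_Y] real_vector.subspace_neg[OF subspace_Y]
  real_vector.subspace_scale[OF subspace_Y]

lemma map_in_Y: "x \<in> X \<Longrightarrow> i x \<in> Y"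
  using cover by (auto simp: vector_lattice_cover_def)

lemma map_add: "x \<in> X \<Longrightarrow> y \<in> X \<Longrightarrow> i (x + y) = i x + i y"
  and map_scaleR: "x \<in> X \<Longrightarrow> i (c *\<^sub>R x) = c *\<^sub>R i x"
  using cover by (auto simp: vector_lattice_cover_def linear_map_on_def)

lemma map_0: "i 0 = 0"
  using map_scaleR[of 0 0] X_closed by simp

lemma map_neg: "x \<in> X \<Longrightarrow> i (- x) = - i x"
  using map_scaleR[of x "-1"] by simp

lemma map_diff: "x \<in> X \<Longrightarrow> y \<in> X \<Longrightarrow> i (x - y) = i x - i y"
  using map_add[of x "- y"] by (simp add: map_neg X_closed)

lemma map_le_iff: "x \<in> X \<Longrightarrow> y \<in> X \<Longrightarrow> i x \<le> i y \<longleftrightarrow> x \<le> y"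
  using cover map_diff[of y x] X_closed(3)[of y x]
  by (auto simp: vector_lattice_cover_def bipositive_on_def)

lemma map_less_iff: "x \<in> X \<Longrightarrow> y \<in> X \<Longrightarrow> i x < i y \<longleftrightarrow> x < y"
  by (simp add: less_le_not_le map_le_iff)

text \<open>Order density in its working form: inequalities in \<open>Y\<close> can be tested on
  elements coming from \<open>X\<close>.\<close>

lemma le_if_below_majorants:
  assumes "z \<in> Y" "l \<in> Y" "\<And>x. x \<in> X \<Longrightarrow> z \<le> i x \<Longrightarrow> l \<le> i x"
  shows "l \<le> z"
proof -
  have "isGlb Y {d \<in> i ` X. z \<le> d} z"
    using cover assms(1) by (auto simp: vector_lattice_cover_def order_dense_def)
  moreover have "\<forall>d\<in>{d \<in> i ` X. z \<le> d}. l \<le> d"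
    using assms(3) by blast
  ultimately show ?thesis
    using assms(2) by (simp add: isGlb_iff)
qed

text \<open>The reflection of the previous test under negation, which preserves the image of
  \<open>X\<close>.\<close>

lemma le_if_above_minorants:
  assumes "z \<in> Y" "u \<in> Y" "\<And>x. x \<in> X \<Longrightarrow> i x \<le> z \<Longrightarrow> i x \<le> u"
  shows "z \<le> u"
proof -
  have "- u \<le> i x" if "x \<in> X" "- z \<le> i x" for x
    using assms(3)[of "- x"] that by (simp add: map_neg X_closed minus_le_iff)
  then have "- u \<le> - z"
    using le_if_below_majorants[OF Y_closed(4)[OF assms(1)] Y_closed(4)[OF assms(2)]] by blast
  then show ?thesis by simp
qed

lemma sup_exists:
  assumes "x \<in> Y" "y \<in> Y"
  obtains s where "s \<in> Y" "x \<le> s" "y \<le> s" "\<And>u. u \<in> Y \<Longrightarrow> x \<le> u \<Longrightarrow> y \<le> u \<Longrightarrow> s \<le> u"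
proof -
  have "\<exists>s. isLub Y {x, y} s"
    using cover assms by (simp add: vector_lattice_cover_def vector_lattice_def)
  then obtain s where "isLub Y {x, y} s" ..
  then show ?thesis
    by (intro that[of s]) (simp_all add: isLub_pair_iff)
qed

lemma inf_exists:
  assumes "x \<in> Y" "y \<in> Y"
  obtains s where "s \<in> Y" "s \<le> x" "s \<le> y" "\<And>u. u \<in> Y \<Longrightarrow> u \<le> x \<Longrightarrow> u \<le> y \<Longrightarrow> u \<le> s"
proof -
  have "\<exists>s. isGlb Y {x, y} s"
    using cover assms by (simp add: vector_lattice_cover_def vector_lattice_def)
  then obtain s where "isGlb Y {x, y} s" ..
  then show ?thesis
    by (intro that[of s]) (simp_all add: isGlb_pair_iff)
qed

section \<open>Independence of pervasiveness from the cover\<close>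

definition pervasive_cover :: bool where
  "pervasive_cover \<longleftrightarrow> (\<forall>y\<in>Y. 0 < y \<longrightarrow> (\<exists>x\<in>X. 0 < i x \<and> i x \<le> y))"

text \<open>The right-hand side involves only the order of \<open>X\<close>, so it carries
  pervasiveness between covers living in different types.\<close>

lemma pervasive_cover_iff:
  "pervasive_cover \<longleftrightarrow>
     (\<forall>x\<in>X. \<not> x \<le> 0 \<longrightarrow> (\<exists>w\<in>X. 0 < w \<and> (\<forall>z\<in>ubs X {x, 0}. w \<le> z)))"
    (is "_ \<longleftrightarrow> ?intrinsic")
proof
  assume perv: pervasive_cover
  show ?intrinsic
  proof (intro ballI impI)
    fix x assume x: "x \<in> X" "\<not> x \<le> 0"
    \<comment> \<open>\<open>s\<close> is the positive part of \<open>i x\<close> in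
      \<open>Y\<close>.\<close>
    obtain s where s: "s \<in> Y" "i x \<le> s" "0 \<le> s"
      "\<And>u. u \<in> Y \<Longrightarrow> i x \<le> u \<Longrightarrow> 0 \<le> u \<Longrightarrow> s \<le> u"
      using sup_exists[OF map_in_Y[OF x(1)] Y_closed(1)] by blast
    have "s \<noteq> 0"
      using s(2) x map_le_iff[OF x(1) X_closed(1)] map_0 by auto
    then have "0 < s" using s(3) by (simp add: less_le)
    then obtain w where w: "w \<in> X" "0 < i w" "i w \<le> s"
      using perv s(1) unfolding pervasive_cover_def by blast
    have "w \<le> z" if "z \<in> ubs X {x, 0}" for z
    proof -
      from that have z: "z \<in> X" "x \<le> z" "0 \<le> z"
        by (auto simp: mem_ubs_pair_iff)
      then have "s \<le> i z"
        using s(4)[of "i z"] x map_le_iff[of x z] map_le_iff[of 0 z] map_0 X_closed(1)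
        by (auto simp: map_in_Y)
      then have "i w \<le> i z" using w(3) by simp
      then show ?thesis using w(1) z(1) map_le_iff by simp
    qed
    moreover have "0 < w"
      using w map_less_iff[OF X_closed(1) w(1)] map_0 by simp
    ultimately show "\<exists>w\<in>X. 0 < w \<and> (\<forall>z\<in>ubs X {x, 0}. w \<le> z)"
      using w(1) by blast
  qed
next
  assume intrinsic: ?intrinsic
  show pervasive_cover
    unfolding pervasive_cover_def
  proof (intro ballI impI)
    fix y assume y: "y \<in> Y" "0 < y"
    then have "\<not> y \<le> 0" by auto
    \<comment> \<open>If every minorant of \<open>y\<close> from \<open>X\<close> were \<le> 0,
      order density from below would give \<open>y \<le> 0\<close>.\<close>
    then obtain x where x: "x \<in> X" "i x \<le> y" "\<not> i x \<le> 0"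
      using le_if_above_minorants[OF y(1) Y_closed(1)] by blast
    then have "\<not> x \<le> 0"
      using map_le_iff[OF x(1) X_closed(1)] map_0 by simp
    then obtain w where w: "w \<in> X" "0 < w" "\<And>z. z \<in> ubs X {x, 0} \<Longrightarrow> w \<le> z"
      using intrinsic x(1) by blast
    \<comment> \<open>Since \<open>y\<close> dominates \<open>i x\<close> and 0, every majorant of
      \<open>y\<close> from \<open>X\<close> lies in \<open>ubs X {x, 0}\<close>; order density then
      yields \<open>i w \<le> y\<close>.\<close>
    have "i w \<le> i z" if z: "z \<in> X" "y \<le> i z" for z
    proof -
      have "i x \<le> i z" "i 0 \<le> i z"
        using x(2) z(2) y(2) map_0 by auto
      then have "z \<in> ubs X {x, 0}"
        using map_le_iff z(1) x(1) X_closed(1) by (auto simp: mem_ubs_pair_iff)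
      then show ?thesis using w z(1) map_le_iff by simp
    qed
    then have "i w \<le> y"
      using le_if_below_majorants[OF y(1) map_in_Y[OF w(1)]] by blast
    moreover have "0 < i w"
      using w map_less_iff[OF X_closed(1) w(1)] map_0 by simp
    ultimately show "\<exists>x\<in>X. 0 < i x \<and> i x \<le> y"
      using w(1) by blast
  qed
qed

lemma pervasive_cover_if_pervasive_space:
  assumes "pervasive_space TYPE('c::ordered_real_vector) X"
  shows pervasive_cover
proof -
  obtain Z :: "'c set" and j where "vector_lattice_cover X Z j"
    and Z: "\<And>y. y \<in> Z \<Longrightarrow> 0 \<le> y \<and> y \<noteq> 0 \<Longrightarrow> \<exists>x\<in>X. 0 < j x \<and> j x \<le> y"
    using assms unfolding pervasive_space_def by blast
  then interpret Z: lattice_cover X Z j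
    by unfold_locales
  have "Z.pervasive_cover"
    unfolding Z.pervasive_cover_def using Z by (metis less_le)
  then show ?thesis
    unfolding Z.pervasive_cover_iff pervasive_cover_iff .
qed

end

section \<open>The smallest extension ideal of a directed ideal\<close>

locale directed_ideal_cover = lattice_cover X Y i
  for X :: "'a::ordered_real_vector set" and Y :: "'b::ordered_real_vector set" and i +
  fixes I :: "'a set"
  assumes ideal: "ideal_in X I" and directed: "directed_subspace I"
begin

text \<open>The ideal of \<open>Y\<close> generated by the image of \<open>I\<close>. The bound on
  the absolute value of \<open>y\<close> is split into two inequalities because the carrier has no
  absolute value operation.\<close>

definition dominated :: "'b set" where
  "dominated = {y \<in> Y. \<exists>a\<in>I. y \<le> i a \<and> - y \<le> i a}"

lemma dominatedI: "y \<in> Y \<Longrightarrow> a \<in> I \<Longrightarrow> y \<le> i a \<Longrightarrow> - y \<le> i a \<Longrightarrow> y \<in> dominated"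
  by (auto simp: dominated_def)

lemma subspace_I: "subspace I"
  using ideal by (auto simp: ideal_in_def)

lemmas I_closed = real_vector.subspace_0[OF subspace_I] real_vector.subspace_add[OF subspace_I]
  real_vector.subspace_diff[OF subspace_I] real_vector.subspace_neg[OF subspace_I]

lemma I_subset: "x \<in> I \<Longrightarrow> x \<in> X"
  using ideal by (auto simp: ideal_in_def solid_in_def)

text \<open>Every upper bound of \<open>a\<close> is already an upper bound of \<open>x\<close> and
  \<open>- x\<close>, so solidity applies.\<close>

lemma I_if_bounded:
  assumes "x \<in> X" "a \<in> I" "x \<le> a" "- x \<le> a"
  shows "x \<in> I"
proof -
  have "ubs X {a, - a} \<subseteq> ubs X {x, - x}"
    using assms(3,4) by (auto simp: mem_ubs_pair_iff)
  then show ?thesis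
    using ideal assms(1,2) unfolding ideal_in_def solid_in_def by blast
qed

lemma abs_bound_in_I:
  assumes "x \<in> I"
  obtains a where "a \<in> I" "x \<le> a" "- x \<le> a"
  using directed assms I_closed(4)[OF assms] unfolding directed_subspace_def by blast

text \<open>Directedness bounds \<open>a\<close> and \<open>- a\<close>, and likewise
  \<open>b\<close> and \<open>- b\<close>, by elements of \<open>I\<close>. These are positive, so
  their sum dominates both \<open>a\<close> and \<open>b\<close>.\<close>

lemma common_bound_in_I:
  assumes "a \<in> I" "b \<in> I"
  obtains c where "c \<in> I" "0 \<le> i c" "i a \<le> i c" "i b \<le> i c"
proof -
  obtain a' b' where ab: "a' \<in> I" "a \<le> a'" "- a \<le> a'" "b' \<in> I" "b \<le> b'" "- b \<le> b'"
    using abs_bound_in_I assms by metis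
  then have nn: "0 \<le> a'" "0 \<le> b'"
    using nonneg_if_abs_le by auto
  have "a' + b' \<in> I" using ab I_closed by blast
  moreover have "0 \<le> a' + b'" "a \<le> a' + b'" "b \<le> a' + b'"
    using nn ab add_mono[OF ab(2) nn(2)] add_mono[OF nn(1) ab(5)] by auto
  ultimately show ?thesis
    using that[of "a' + b'"] assms I_subset map_le_iff map_0 X_closed(1) by metis
qed

lemma dominated_between:
  assumes "x \<in> dominated" "z \<in> dominated" "y \<in> Y" "x \<le> y" "y \<le> z"
  shows "y \<in> dominated"
proof -
  obtain a b where ab: "a \<in> I" "- x \<le> i a" "b \<in> I" "z \<le> i b"
    using assms unfolding dominated_def by blast
  obtain c where "c \<in> I" "i a \<le> i c" "i b \<le> i c"
    using common_bound_in_I ab by metis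
  moreover have "- y \<le> i a" "y \<le> i b"
    using ab assms(4,5) by (meson neg_le_iff_le order_trans)+
  ultimately show ?thesis
    using assms(3) dominatedI order_trans by metis
qed

text \<open>The extension property of \<open>dominated\<close>: solidity of \<open>I\<close> gives
  one direction, directedness the other.\<close>

lemma map_in_dominated_iff:
  assumes "x \<in> X"
  shows "i x \<in> dominated \<longleftrightarrow> x \<in> I"
proof
  assume "i x \<in> dominated"
  then obtain a where a: "a \<in> I" "i x \<le> i a" "i (- x) \<le> i a"
    using assms by (auto simp: dominated_def map_neg)
  then have "x \<le> a" "- x \<le> a"
    using map_le_iff[of x a] map_le_iff[of "- x" a] assms I_subset X_closed(4) by auto
  then show "x \<in> I"
    using I_if_bounded a assms by blast
next
  assume "x \<in> I"
  then obtain a where "a \<in> I" "x \<le> a" "- x \<le> a"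
    by (rule abs_bound_in_I)
  then have "i x \<le> i a" "- i x \<le> i a"
    using map_le_iff[of x a] map_le_iff[of "- x" a] assms I_subset X_closed(4) map_neg by auto
  then show "i x \<in> dominated"
    using \<open>a \<in> I\<close> assms map_in_Y unfolding dominated_def by blast
qed

text \<open>The witness \<open>i a\<close> for \<open>y\<close> is itself an upper bound of
  \<open>{y, - y}\<close>, so it also serves for \<open>x\<close>.\<close>

lemma dominated_if_solid_below:
  assumes "x \<in> Y" "y \<in> dominated" "ubs Y {y, - y} \<subseteq> ubs Y {x, - x}"
  shows "x \<in> dominated"
proof -
  obtain a where "a \<in> I" "y \<le> i a" "- y \<le> i a"
    using assms unfolding dominated_def by blast
  then have "i a \<in> ubs Y {y, - y}"
    using map_in_Y I_subset by (simp add: mem_ubs_pair_iff)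
  then have "i a \<in> ubs Y {x, - x}"
    using assms(3) by blast
  then show ?thesis
    using \<open>a \<in> I\<close> assms(1) unfolding dominated_def mem_ubs_pair_iff by blast
qed

lemma subspace_dominated: "subspace dominated"
proof (rule real_vector.subspaceI)
  show "0 \<in> dominated"
    using I_closed(1) Y_closed(1) map_0 by (intro dominatedI[of 0 0]) auto
next
  fix x y assume "x \<in> dominated" "y \<in> dominated"
  then obtain a b where xy: "x \<in> Y" "y \<in> Y"
    and ab: "a \<in> I" "x \<le> i a" "- x \<le> i a" "b \<in> I" "y \<le> i b" "- y \<le> i b"
    unfolding dominated_def by blast
  have "a + b \<in> I" "i (a + b) = i a + i b"
    using ab I_closed map_add I_subset by auto
  moreover have "x + y \<le> i a + i b" "- (x + y) \<le> i a + i b"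
    using add_mono[OF ab(2,5)] add_mono[OF ab(3,6)] by auto
  ultimately show "x + y \<in> dominated"
    using xy Y_closed dominatedI[of "x + y" "a + b"] by auto
next
  fix c :: real and x assume "x \<in> dominated"
  then obtain a where x: "x \<in> Y" and a: "a \<in> I" "x \<le> i a" "- x \<le> i a"
    unfolding dominated_def by blast
  \<comment> \<open>For negative \<open>c\<close> the two bounds on \<open>x\<close> exchange
    roles.\<close>
  have "c *\<^sub>R x \<le> \<bar>c\<bar> *\<^sub>R i a" "- (c *\<^sub>R x) \<le> \<bar>c\<bar> *\<^sub>R i a"
    using scaleR_left_mono[OF a(2) abs_ge_zero[of c]] scaleR_left_mono[OF a(3) abs_ge_zero[of c]]
    by (cases "0 \<le> c"; simp only: abs_of_nonneg abs_of_neg not_le scaleR_minus_left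
        scaleR_minus_right minus_minus)+
  moreover have "\<bar>c\<bar> *\<^sub>R a \<in> I" "i (\<bar>c\<bar> *\<^sub>R a) = \<bar>c\<bar> *\<^sub>R i a"
    using a I_subset map_scaleR real_vector.subspace_scale[OF subspace_I] by auto
  ultimately show "c *\<^sub>R x \<in> dominated"
    using x Y_closed dominatedI[of "c *\<^sub>R x" "\<bar>c\<bar> *\<^sub>R a"] by auto
qed

text \<open>\<open>dominated\<close> is one of the intersected ideals, and any other extension ideal
  contains the image of \<open>I\<close> and hence, by solidity, everything dominated by it.\<close>

lemma smallest_extension_ideal_eq: "smallest_extension_ideal X Y i I = dominated"
proof -
  have "solid_in Y dominated"
    using dominated_if_solid_below unfolding solid_in_def dominated_def by blast
  then have "extension_ideal X Y i I dominated"
    using subspace_dominated map_in_dominated_iff I_subset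
    by (auto simp: extension_ideal_def ideal_in_def)
  moreover have "dominated \<subseteq> J" if J: "extension_ideal X Y i I J" for J
  proof
    fix y assume "y \<in> dominated"
    then obtain a where a: "y \<in> Y" "a \<in> I" "y \<le> i a" "- y \<le> i a"
      unfolding dominated_def by blast
    then have "i a \<in> J"
      using J by (auto simp: extension_ideal_def)
    moreover have "ubs Y {i a, - i a} \<subseteq> ubs Y {y, - y}"
      using a by (auto simp: mem_ubs_pair_iff)
    ultimately show "y \<in> J"
      using J a(1) unfolding extension_ideal_def ideal_in_def solid_in_def by blast
  qed
  ultimately show ?thesis
    unfolding smallest_extension_ideal_def by blast
qed

section \<open>Lattice operations in the extension ideal\<close>

lemma vector_lattice_dominated: "vector_lattice dominated"
  unfolding vector_lattice_def
proof (intro conjI ballI subspace_dominated)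
  fix x y assume xy: "x \<in> dominated" "y \<in> dominated"
  then have Y: "x \<in> Y" "y \<in> Y" by (auto simp: dominated_def)
  obtain a b where ab: "a \<in> I" "x \<le> i a" "- x \<le> i a" "b \<in> I" "y \<le> i b" "- y \<le> i b"
    using xy unfolding dominated_def by blast
  obtain c where c: "c \<in> I" "i a \<le> i c" "i b \<le> i c"
    using common_bound_in_I ab by metis
  have "i c \<in> dominated"
    using c map_in_dominated_iff I_subset by blast
  have cY: "i c \<in> Y" "- i c \<in> Y"
    using c map_in_Y I_subset Y_closed by auto
  have bounds: "x \<le> i c" "y \<le> i c" "- i c \<le> x" "- i c \<le> y"
    using ab c by (auto simp: minus_le_iff intro: order_trans)
  obtain s where s: "s \<in> Y" "x \<le> s" "y \<le> s"
    "\<And>u. u \<in> Y \<Longrightarrow> x \<le> u \<Longrightarrow> y \<le> u \<Longrightarrow> s \<le> u"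
    using sup_exists[OF Y] by blast
  \<comment> \<open>The supremum formed in \<open>Y\<close> lies between \<open>x\<close> and
    \<open>i c\<close>; dually, the infimum lies between \<open>- i c\<close> and \<open>x\<close>.
    Being optimal in \<open>Y\<close>, both remain optimal in the smaller carrier.\<close>
  have "s \<in> dominated"
    using dominated_between[OF xy(1) \<open>i c \<in> dominated\<close> s(1,2)] s(4) cY bounds by blast
  then show "\<exists>s. isLub dominated {x, y} s"
    using s unfolding isLub_pair_iff dominated_def by blast
  obtain t where t: "t \<in> Y" "t \<le> x" "t \<le> y"
    "\<And>u. u \<in> Y \<Longrightarrow> u \<le> x \<Longrightarrow> u \<le> y \<Longrightarrow> u \<le> t"
    using inf_exists[OF Y] by blast
  have "- i c \<in> dominated"
    using \<open>i c \<in> dominated\<close> real_vector.subspace_neg[OF subspace_dominated] by blast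
  then have "t \<in> dominated"
    using dominated_between[OF _ xy(1) t(1) _ t(2)] t(4) cY bounds by blast
  then show "\<exists>t. isGlb dominated {x, y} t"
    using t unfolding isGlb_pair_iff dominated_def by blast
qed

section \<open>Order density via the Archimedean property\<close>

lemma map_between_in_I:
  assumes "x \<in> X" "0 \<le> i x" "i x \<le> u" "u \<in> dominated"
  shows "x \<in> I"
  using dominated_between[OF _ assms(4) map_in_Y[OF assms(1)] assms(2,3)]
    real_vector.subspace_0[OF subspace_dominated] map_in_dominated_iff assms(1) by blast

lemma nonneg_le_upper_bound:
  assumes "archimedean_space X" pervasive_cover
    and u: "u \<in> dominated" "0 \<le> u" and m: "m \<in> Y"
    and ub: "\<And>d. d \<in> I \<Longrightarrow> i d \<le> u \<Longrightarrow> i d \<le> m"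
  shows "u \<le> m"
proof (rule ccontr)
  assume "\<not> u \<le> m"
  have uY: "u \<in> Y" using u by (auto simp: dominated_def)
  obtain t where t: "t \<in> Y" "t \<le> u" "t \<le> m"
    "\<And>v. v \<in> Y \<Longrightarrow> v \<le> u \<Longrightarrow> v \<le> m \<Longrightarrow> v \<le> t"
    using inf_exists[OF uY m] by blast
  have "u \<noteq> t" using t(3) \<open>\<not> u \<le> m\<close> by auto
  then have "0 < u - t" using t(2) by (simp add: less_le)
  then obtain w where w: "w \<in> X" "0 < i w" "i w \<le> u - t"
    using assms(2) Y_closed(3)[OF uY t(1)] unfolding pervasive_cover_def by blast
  \<comment> \<open>Positivity belongs to the induction claim because, together with the bound
    \<open>u\<close>, it places the multiple in \<open>I\<close>, where \<open>ub\<close> is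
    available.\<close>
  have multiples: "0 \<le> i (real n *\<^sub>R w) \<and> i (real n *\<^sub>R w) \<le> u" for n
  proof (induction n)
    case 0
    then show ?case using u(2) map_0 by simp
  next
    case (Suc n)
    let ?d = "real n *\<^sub>R w"
    have d: "?d \<in> X" using w(1) by (rule X_closed)
    have "?d \<in> I" using map_between_in_I[OF d _ _ u(1)] Suc by simp
    then have "i ?d \<le> t" using t(4)[OF map_in_Y[OF d]] ub Suc by simp
    moreover have "i (real (Suc n) *\<^sub>R w) = i ?d + i w"
      using d w(1) by (simp add: algebra_simps flip: map_add)
    ultimately show ?case
      using Suc w(2) add_mono[OF \<open>i ?d \<le> t\<close> w(3)] by (auto intro: add_nonneg_nonneg)
  qed
  \<comment> \<open>The Archimedean property is assumed in \<open>X\<close>, so the bound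
    \<open>u\<close> from \<open>Y\<close> is replaced by an element of \<open>I\<close>.\<close>
  obtain c where c: "c \<in> I" "u \<le> i c"
    using u(1) unfolding dominated_def by blast
  have "real n *\<^sub>R w \<le> c" for n
    using multiples[of n] c w(1) map_le_iff[of "real n *\<^sub>R w" c] I_subset X_closed(5) order_trans
    by blast
  then have "w \<le> 0"
    using assms(1) w(1) c(1) I_subset unfolding archimedean_space_def by blast
  then show False
    using w map_le_iff[OF w(1) X_closed(1)] map_0 by auto
qed

lemma order_dense_dominated:
  assumes "archimedean_space X" pervasive_cover
  shows "order_dense (i ` I) dominated"
  unfolding order_dense_def
proof (intro conjI ballI)
  show "subspace (i ` I)"
  proof (rule real_vector.subspaceI)
    show "0 \<in> i ` I" using I_closed(1) map_0 by force
  next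
    fix x y assume "x \<in> i ` I" "y \<in> i ` I"
    then show "x + y \<in> i ` I"
      using I_closed I_subset by (auto simp flip: map_add)
  next
    fix c :: real and x assume "x \<in> i ` I"
    then show "c *\<^sub>R x \<in> i ` I"
      using real_vector.subspace_scale[OF subspace_I] I_subset by (auto simp flip: map_scaleR)
  qed
next
  show "i ` I \<subseteq> dominated"
    using map_in_dominated_iff I_subset by blast
next
  fix z assume z: "z \<in> dominated"
  then obtain a where a: "a \<in> I" "z \<le> i a"
    unfolding dominated_def by blast
  have "l \<le> z" if l: "l \<in> dominated" "\<forall>x\<in>{d \<in> i ` I. z \<le> d}. l \<le> x" for l
  proof -
    \<comment> \<open>The reflection of \<open>d\<close> to \<open>a - d\<close> turns minorants of
      \<open>i a - z\<close> into majorants of \<open>z\<close>, so \<open>i a - l\<close> bounds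
      all these minorants. The choice of \<open>a\<close> makes \<open>i a - z\<close>
      positive.\<close>
    have "i d \<le> i a - l" if d: "d \<in> I" "i d \<le> i a - z" for d
    proof -
      have "i (a - d) = i a - i d" "a - d \<in> I"
        using a d map_diff I_subset I_closed by auto
      moreover have "z \<le> i a - i d"
        using d(2) by (simp add: algebra_simps)
      ultimately have "l \<le> i a - i d"
        using l(2) by (metis (mono_tags, lifting) imageI mem_Collect_eq)
      then show ?thesis by (simp add: algebra_simps)
    qed
    moreover have "i a \<in> dominated"
      using a map_in_dominated_iff I_subset by blast
    then have "i a - z \<in> dominated" "i a - l \<in> dominated"
      using z l real_vector.subspace_diff[OF subspace_dominated] by blast+
    moreover have "i a - l \<in> Y"
      using calculation unfolding dominated_def by blast
    ultimately have "i a - z \<le> i a - l"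
      using nonneg_le_upper_bound[OF assms, of "i a - z" "i a - l"] a(2) by simp
    then show ?thesis by simp
  qed
  then show "isGlb dominated {d \<in> i ` I. z \<le> d} z"
    using z unfolding isGlb_iff by blast
qed

lemma vector_lattice_cover_dominated:
  assumes "archimedean_space X" pervasive_cover
  shows "vector_lattice_cover I dominated i"
proof -
  have "linear_map_on I i"
    by (simp add: linear_map_on_def map_add map_scaleR I_subset)
  moreover have "bipositive_on I i"
    using cover by (simp add: vector_lattice_cover_def bipositive_on_def I_subset)
  moreover have "i ` I \<subseteq> dominated"
    using map_in_dominated_iff I_subset by blast
  ultimately show ?thesis
    using subspace_I vector_lattice_dominated order_dense_dominated[OF assms]
    by (simp add: vector_lattice_cover_def)
qed

text \<open>An element of \<open>X\<close> whose image lies between 0 and an element of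
  \<open>dominated\<close> is automatically in \<open>I\<close>.\<close>

lemma pervasive_dominated:
  assumes pervasive_cover "y \<in> dominated" "0 \<le> y" "y \<noteq> 0"
  shows "\<exists>x\<in>I. 0 < i x \<and> i x \<le> y"
proof -
  have "y \<in> Y" "0 < y" using assms by (auto simp: dominated_def less_le)
  then obtain x where x: "x \<in> X" "0 < i x" "i x \<le> y"
    using assms(1) unfolding pervasive_cover_def by blast
  then have "x \<in> I"
    using map_between_in_I assms(2) by (meson less_imp_le)
  then show ?thesis using x by blast
qed

end

theorem theorem27:
  fixes X I :: "'a::ordered_real_vector set"
    and Y :: "'b::ordered_real_vector set"
    and i :: "'a \<Rightarrow> 'b"
  assumes "archimedean_space X"
    and "pre_riesz_space TYPE('c::ordered_real_vector) X"
    and "pervasive_space TYPE('c) X"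
    and "vector_lattice_cover X Y i"
    and "ideal_in X I"
    and "directed_subspace I"
  shows "vector_lattice_cover I (smallest_extension_ideal X Y i I) i
    \<and> pre_riesz_space TYPE('b) I
    \<and> pervasive_space TYPE('b) I"
proof -
  interpret directed_ideal_cover X Y i I
    using assms by unfold_locales
  \<comment> \<open>The hypothesis provides some pervasive cover of type \<open>'c\<close>; the
    intrinsic criterion transfers the property to the given cover \<open>Y\<close>.\<close>
  have perv: pervasive_cover
    using pervasive_cover_if_pervasive_space assms(3) .
  note lattice = vector_lattice_cover_dominated[OF assms(1) perv]
  have "pre_riesz_space TYPE('b) I"
    using lattice unfolding pre_riesz_space_def by blast
  moreover have "pervasive_space TYPE('b) I"
    using lattice pervasive_dominated[OF perv] unfolding pervasive_space_def by blast
  ultimately show ?thesis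
    using lattice smallest_extension_ideal_eq by simp
qed

end
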